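(* Let $z,x\in\mathbb R$ and let $X$ be a time-changed Lévy process of law $\mathbb P_x$ with lifetime $\zeta$. Then $\Phi_z(X)$ has law $\mathbb P_{x+z}$, and the lifetime of $\Phi_z(X)$ is $$\zeta'=\int_0^\zeta\frac{R(X_s)}{R(z+X_s)}\,ds.$$
   Context: $\xi$ is a non-lattice, unkilled Lévy process on $\mathbb R$, with law $\mathrm P_x$ when started from $x$. $R:\mathbb R\to(0,\infty)$ is continuous, with $\liminf_{x\to-\infty}1/R(x)>0$ and $\liminf_{x\to-\infty}R(x)/R(z+x)>0$ for every $z\in\mathbb R$ (standing assumptions). The time-changed Lévy process: under $\mathrm P_0$, for $x\in\mathbb R$, $X_t=x+\xi_{\eta(t)}$ with $\eta(t)=\inf\{s>0:\int_0^s \frac{dr}{R(x+\xi_r)}>t\}$ for $t<\zeta:=\int_0^\infty\frac{dr}{R(x+\xi_r)}$, and $X_t=+\infty$ for $t\ge\zeta$; $\mathbb P_x$ denotes the law of $X$ and $\zeta$ is its lifetime (first time at $+\infty$). For $z\in\mathbb R$ and a càdlàg path $w$ in $(-\infty,\infty]$ let $g(z,x)=R(x)/R(z+x)$ for $x\in\mathbb R$, $g(z,\infty)=1$, $h_z(t)=\inf\{s\ge0:\int_0^s g(z,w_u)\,du>t\}$, and $\Phi_z(w)_t=z+w_{h_z(t)}$, $t\ge 0$, with the convention $\Phi_z(w)_t=+\infty$ for $t\ge\int_0^\infty g(z,w_u)\,du$. *)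

theory Defs
  imports "HOL-Probability.Probability"
begin

text \<open>Time is the half-line \<open>{0..}\<close> of the reals; values of paths at negative times play no role.\<close>

definition cadlag_in :: "'b::topological_space set \<Rightarrow> (real \<Rightarrow> 'b) \<Rightarrow> bool" where
  "cadlag_in S w \<longleftrightarrow>
     (\<forall>t\<ge>0. w t \<in> S \<and> (w \<longlongrightarrow> w t) (at_right t)) \<and>
     (\<forall>t>0. \<exists>l\<in>S. (w \<longlongrightarrow> l) (at_left t))"

definition levy_process :: "'a measure \<Rightarrow> (real \<Rightarrow> 'a \<Rightarrow> real) \<Rightarrow> bool" where
  "levy_process M \<xi> \<longleftrightarrow>
     prob_space M \<and>
     (\<forall>t\<ge>0. \<xi> t \<in> borel_measurable M) \<and>
     (AE \<omega> in M. \<xi> 0 \<omega> = 0) \<and>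
     (AE \<omega> in M. cadlag_in UNIV (\<lambda>t. \<xi> t \<omega>)) \<and>
     (\<forall>s\<ge>0. \<forall>t\<ge>0. distr M borel (\<lambda>\<omega>. \<xi> (s + t) \<omega> - \<xi> s \<omega>) = distr M borel (\<xi> t)) \<and>
     (\<forall>(n::nat) t. 0 \<le> t 0 \<and> (\<forall>i<n. t i \<le> t (Suc i)) \<longrightarrow>
        prob_space.indep_vars M (\<lambda>_. borel) (\<lambda>i \<omega>. \<xi> (t (Suc i)) \<omega> - \<xi> (t i) \<omega>) {..<n})"

definition non_lattice :: "'a measure \<Rightarrow> (real \<Rightarrow> 'a \<Rightarrow> real) \<Rightarrow> bool" where
  "non_lattice M \<xi> \<longleftrightarrow>
     \<not> (\<exists>h>0. \<forall>t\<ge>0. AE \<omega> in M. \<exists>k::int. \<xi> t \<omega> = of_int k * h)"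

definition admissible_rate :: "(real \<Rightarrow> real) \<Rightarrow> bool" where
  "admissible_rate R \<longleftrightarrow>
     continuous_on UNIV R \<and> (\<forall>y. 0 < R y) \<and>
     0 < Liminf at_bot (\<lambda>y. ereal (1 / R y)) \<and>
     (\<forall>z. 0 < Liminf at_bot (\<lambda>y. ereal (R y / R (z + y))))"


subsection \<open>Path laws\<close>

text \<open>
  Laws of processes with values in the extended reals are measures on the product
  \<open>\<sigma>\<close>-algebra generated by the coordinates (whose trace on the cadlag paths is the Borel
  \<open>\<sigma>\<close>-algebra of the Skorokhod topology). Paths are only required to be cadlag
  almost surely, and functionals of such paths are measurable only up to a null set; this is
  why the underlying probability space is completed.
\<close>

definition path_space :: "(real \<Rightarrow> ereal) measure" where
  "path_space = (\<Pi>\<^sub>M t\<in>{0..}. borel)"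

definition path_law :: "'a measure \<Rightarrow> (real \<Rightarrow> 'a \<Rightarrow> ereal) \<Rightarrow> (real \<Rightarrow> ereal) measure" where
  "path_law M Y = distr (completion M) path_space (\<lambda>\<omega>. \<lambda>t\<in>{0..}. Y t \<omega>)"

definition has_path_law ::
    "'a measure \<Rightarrow> (real \<Rightarrow> 'a \<Rightarrow> ereal) \<Rightarrow> (real \<Rightarrow> ereal) measure \<Rightarrow> bool" where
  "has_path_law M Y \<mu> \<longleftrightarrow>
     (\<forall>t\<ge>0. Y t \<in> borel_measurable (completion M)) \<and> path_law M Y = \<mu>"

text \<open>First time at \<open>\<infinity>\<close>, equal to \<open>top\<close> if the path never reaches it.\<close>

definition lifetime :: "(real \<Rightarrow> ereal) \<Rightarrow> ennreal" where
  "lifetime w = (INF t\<in>{t. 0 \<le> t \<and> w t = \<infinity>}. ennreal t)"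


subsection \<open>Time-changed paths\<close>

definition clock :: "(real \<Rightarrow> real) \<Rightarrow> real \<Rightarrow> (real \<Rightarrow> real) \<Rightarrow> real \<Rightarrow> ennreal" where
  "clock R x v s = (\<integral>\<^sup>+r\<in>{0..s}. ennreal (1 / R (x + v r)) \<partial>lborel)"

definition total_clock :: "(real \<Rightarrow> real) \<Rightarrow> real \<Rightarrow> (real \<Rightarrow> real) \<Rightarrow> ennreal" where
  "total_clock R x v = (\<integral>\<^sup>+r\<in>{0..}. ennreal (1 / R (x + v r)) \<partial>lborel)"

text \<open>The real infimum below is only used for \<open>t < total_clock R x v\<close>, where the set is nonempty.\<close>

definition inverse_clock :: "(real \<Rightarrow> real) \<Rightarrow> real \<Rightarrow> (real \<Rightarrow> real) \<Rightarrow> real \<Rightarrow> real" where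
  "inverse_clock R x v t = Inf {s. 0 < s \<and> ennreal t < clock R x v s}"

definition time_change :: "(real \<Rightarrow> real) \<Rightarrow> real \<Rightarrow> (real \<Rightarrow> real) \<Rightarrow> real \<Rightarrow> ereal" where
  "time_change R x v t =
     (if ennreal t < total_clock R x v then ereal (x + v (inverse_clock R x v t)) else \<infinity>)"

definition time_changed_law ::
    "'a measure \<Rightarrow> (real \<Rightarrow> 'a \<Rightarrow> real) \<Rightarrow> (real \<Rightarrow> real) \<Rightarrow> real \<Rightarrow> (real \<Rightarrow> ereal) measure" where
  "time_changed_law M \<xi> R x = path_law M (\<lambda>t \<omega>. time_change R x (\<lambda>s. \<xi> s \<omega>) t)"


subsection \<open>The shift map on paths\<close>

definition shift_rate :: "(real \<Rightarrow> real) \<Rightarrow> real \<Rightarrow> ereal \<Rightarrow> real" where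
  "shift_rate R z y =
     (if y = \<infinity> then 1 else R (real_of_ereal y) / R (z + real_of_ereal y))"

definition shift_time :: "(real \<Rightarrow> real) \<Rightarrow> real \<Rightarrow> (real \<Rightarrow> ereal) \<Rightarrow> real \<Rightarrow> real" where
  "shift_time R z w t =
     Inf {s. 0 \<le> s \<and> ennreal t < (\<integral>\<^sup>+u\<in>{0..s}. ennreal (shift_rate R z (w u)) \<partial>lborel)}"

definition shift_path :: "(real \<Rightarrow> real) \<Rightarrow> real \<Rightarrow> (real \<Rightarrow> ereal) \<Rightarrow> real \<Rightarrow> ereal" where
  "shift_path R z w t =
     (if ennreal t < (\<integral>\<^sup>+u\<in>{0..}. ennreal (shift_rate R z (w u)) \<partial>lborel)
      then ereal z + w (shift_time R z w t) else \<infinity>)"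

end

theory Submission
  imports Defs
begin

text \<open>
  Let \<open>C\<close> and \<open>C'\<close> be the clocks of one path of the Levy process started at \<open>x\<close> and at \<open>x + z\<close>, and
  let \<open>Y\<close> be the path started at \<open>x\<close> after its time change.
  Substituting \<open>u = C(r)\<close> gives \<open>\<integral>\<^sub>0\<^sup>s g(z, Y\<^sub>u) du = C'(r)\<close> for \<open>s = C(r)\<close>, so the time change in the shift map
  takes \<open>C'(r)\<close> to \<open>C(r)\<close>, and the shift map sends \<open>Y\<close> to the time-changed path started at \<open>x + z\<close>,
  for every cadlag path. On right-continuous paths the shift map agrees with a
  functional measurable for the product \<open>\<sigma>\<close>-algebra, obtained by recovering the path from its values on
  finer and finer grids; this carries the pathwise identity over to any process with the same law.
  The lifetime formula is again pathwise, once the path is known to be absorbed at infinity, and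
  absorption can be read off from the law.
\<close>

section \<open>Right-continuous paths on a grid\<close>

definition right_continuous_path :: "(real \<Rightarrow> 'b::topological_space) \<Rightarrow> bool" where
  "right_continuous_path w \<longleftrightarrow> (\<forall>t\<ge>0. (w \<longlongrightarrow> w t) (at_right t))"

lemma right_continuous_pathD:
  "right_continuous_path w \<Longrightarrow> 0 \<le> t \<Longrightarrow> (w \<longlongrightarrow> w t) (at_right t)"
  by (simp add: right_continuous_path_def)

lemma cadlag_in_imp_right_continuous_path: "cadlag_in S w \<Longrightarrow> right_continuous_path w"
  by (simp add: cadlag_in_def right_continuous_path_def)

text \<open>For \<open>r\<close> nonnegative this is the least multiple of
  \<open>1 / (n + 1)\<close> strictly above \<open>r\<close>; strictness is what lets limits from
  the right suffice. It takes only countably many values, and \<open>nat\<close> keeps them positive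
  even for negative \<open>r\<close>.\<close>

definition grid_time :: "nat \<Rightarrow> real \<Rightarrow> real" where
  "grid_time n r = (real (nat \<lfloor>real (Suc n) * r\<rfloor>) + 1) / real (Suc n)"

lemma grid_time_at_right:
  assumes "0 \<le> r"
  shows "filterlim (\<lambda>n. grid_time n r) (at_right r) sequentially"
proof (rule tendsto_imp_filterlim_at_right)
  have fl: "real (nat \<lfloor>real (Suc n) * r\<rfloor>) = of_int \<lfloor>real (Suc n) * r\<rfloor>" for n
  proof (rule of_nat_nat)
    have "0 \<le> real (Suc n) * r" using assms by simp
    then show "0 \<le> \<lfloor>real (Suc n) * r\<rfloor>" by (simp only: zero_le_floor)
  qed
  have gt: "r < grid_time n r" for n
    unfolding grid_time_def fl
    by (subst pos_less_divide_eq) (auto simp: mult.commute)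
  have le: "grid_time n r \<le> r + inverse (real (Suc n))" for n
  proof -
    have "real (Suc n) * grid_time n r = of_int \<lfloor>real (Suc n) * r\<rfloor> + 1"
      by (simp add: grid_time_def fl del: of_nat_Suc)
    also have "\<dots> \<le> real (Suc n) * r + 1" by simp
    also have "\<dots> = real (Suc n) * (r + inverse (real (Suc n)))"
      by (simp add: distrib_left del: of_nat_Suc)
    finally show ?thesis by (simp del: of_nat_Suc)
  qed
  have "(\<lambda>n. r + inverse (real (Suc n))) \<longlonglongrightarrow> r + 0"
    by (intro tendsto_add tendsto_const LIMSEQ_inverse_real_of_nat)
  then have lim: "(\<lambda>n. r + inverse (real (Suc n))) \<longlonglongrightarrow> r" by simp
  show "(\<lambda>n. grid_time n r) \<longlonglongrightarrow> r"
    by (rule tendsto_sandwich[OF _ _ tendsto_const lim])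
       (auto simp: le less_imp_le[OF gt] simp del: of_nat_Suc)
  show "\<forall>\<^sub>F n in sequentially. r < grid_time n r"
    by (simp add: gt)
qed

text \<open>The \<open>liminf\<close> exists for every path and preserves measurability; where the
  values converge it is their limit.\<close>

definition grid_limit :: "(real \<Rightarrow> ereal) \<Rightarrow> real \<Rightarrow> ereal" where
  "grid_limit w r = liminf (\<lambda>n. w (grid_time n r))"

lemma grid_limit_eq:
  assumes "right_continuous_path w" and "0 \<le> r"
  shows "grid_limit w r = w r"
  unfolding grid_limit_def
  by (intro lim_imp_Liminf filterlim_compose[OF right_continuous_pathD grid_time_at_right] assms) simp

text \<open>Measurability of each coordinate yields joint measurability in time and parameter: for
  fixed \<open>n\<close> the grid time takes countably many values, so evaluation there is a
  countable case distinction.\<close>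

lemma measurable_grid_limit:
  assumes "\<And>t. 0 \<le> t \<Longrightarrow> Y t \<in> borel_measurable P"
  shows "(\<lambda>q. grid_limit (\<lambda>t. Y t (snd q)) (fst q)) \<in> borel_measurable (borel \<Otimes>\<^sub>M P)"
  unfolding grid_limit_def grid_time_def
proof (intro borel_measurable_liminf)
  fix n
  show "(\<lambda>q. Y ((real (nat \<lfloor>real (Suc n) * fst q\<rfloor>) + 1) / real (Suc n)) (snd q))
      \<in> borel_measurable (borel \<Otimes>\<^sub>M P)"
    by (rule measurable_compose_countable[of "\<lambda>k q. Y ((real k + 1) / real (Suc n)) (snd q)"])
       (auto intro!: measurable_compose[OF measurable_snd] assms)
qed

lemma right_continuous_path_measurable:
  fixes w :: "real \<Rightarrow> ereal"
  assumes "right_continuous_path w"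
  shows "(\<lambda>r. w (max 0 r)) \<in> borel_measurable borel"
proof -
  have "(\<lambda>r. w (max 0 r)) = (\<lambda>r. grid_limit w (max 0 r))"
    using assms by (simp add: grid_limit_eq)
  \<comment> \<open>The second component is a dummy parameter: the joint measurability is applied to
    a process that is constant in it.\<close>
  moreover have "(\<lambda>r. (max 0 r, r)) \<in> borel \<rightarrow>\<^sub>M borel \<Otimes>\<^sub>M (borel :: real measure)"
    by measurable
  from measurable_compose[OF this measurable_grid_limit[of "\<lambda>t _. w t"]]
  have "(\<lambda>r. grid_limit w (max 0 r)) \<in> borel_measurable borel" by simp
  ultimately show ?thesis by simp
qed

lemma right_continuous_path_measurable_real:
  fixes v :: "real \<Rightarrow> real"
  assumes "right_continuous_path v"
  shows "(\<lambda>r. v (max 0 r)) \<in> borel_measurable borel"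
proof -
  have "right_continuous_path (\<lambda>r. ereal (v r))"
    using assms by (simp add: right_continuous_path_def)
  from right_continuous_path_measurable[OF this] show ?thesis
    by (simp add: borel_measurable_ereal_iff)
qed

text \<open>Bisection reduces the claim to short intervals around one point, where the two one-sided
  limits and the value at the point give a bound.\<close>

lemma cadlag_bounded:
  fixes v :: "real \<Rightarrow> real"
  assumes "cadlag_in UNIV v" "0 \<le> s"
  shows "bounded (v ` {0..s})"
proof -
  \<comment> \<open>Short intervals around 0 reach into negative times, where \<open>v\<close> is
    arbitrary; the intersection with \<open>{0..}\<close> removes them.\<close>
  have "bounded (v ` ({0..} \<inter> {0..s}))"
    using assms(2)
  proof (induction rule: Bolzano[where P = "\<lambda>a b. bounded (v ` ({0..} \<inter> {a..b}))"])
    case (trans a b c)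
    then have "bounded (v ` ({0..} \<inter> {a..b}) \<union> v ` ({0..} \<inter> {b..c}))" by simp
    moreover have "v ` ({0..} \<inter> {a..c}) \<subseteq> v ` ({0..} \<inter> {a..b}) \<union> v ` ({0..} \<inter> {b..c})"
      by (subst image_Un[symmetric], rule image_mono) auto
    ultimately show ?case by (rule bounded_subset)
  next
    case (local x)
    have near: "\<forall>\<^sub>F r in F. \<bar>v r\<bar> < \<bar>l\<bar> + 1" if "(v \<longlongrightarrow> l) F" for l and F
      by (rule order_tendstoD[OF tendsto_rabs[OF that]]) simp
    from assms local have "(v \<longlongrightarrow> v x) (at_right x)"
      by (simp add: cadlag_in_def)
    from near[OF this] obtain b where b: "x < b" "\<And>r. x < r \<Longrightarrow> r < b \<Longrightarrow> \<bar>v r\<bar> < \<bar>v x\<bar> + 1"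
      by (auto simp: eventually_at_right_field)
    obtain a l where a: "a < x" "\<And>r. a < r \<Longrightarrow> r < x \<Longrightarrow> 0 \<le> r \<Longrightarrow> \<bar>v r\<bar> < \<bar>l\<bar> + 1"
    proof (cases "x = 0")
      case True
      then show ?thesis by (intro that[of "- 1" 0]) auto
    next
      case False
      with assms local obtain l where "(v \<longlongrightarrow> l) (at_left x)"
        unfolding cadlag_in_def by (metis order_le_imp_less_or_eq)
      from near[OF this] show ?thesis
        by (auto simp: eventually_at_left_field intro: that)
    qed
    have "bounded (v ` ({0..} \<inter> {c..d}))" if "c \<le> x" "x \<le> d" "d - c < min (b - x) (x - a)" for c d
    proof (rule boundedI)
      fix y assume "y \<in> v ` ({0..} \<inter> {c..d})"
      then obtain r where r: "y = v r" "0 \<le> r" "c \<le> r" "r \<le> d" by auto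
      with that a(2)[of r] b(2)[of r] show "norm y \<le> (\<bar>v x\<bar> + 1) + (\<bar>l\<bar> + 1)"
        by (cases r x rule: linorder_cases) auto
    qed
    then show ?case
      using a(1) b(1) by (intro exI[of _ "min (b - x) (x - a)"]) auto
  qed
  then show ?thesis
    by (rule bounded_subset) auto
qed

section \<open>Additive clocks and their inverses\<close>

lemma nn_integral_atLeastAtMost_mono:
  fixes a b c :: real and f :: "real \<Rightarrow> ennreal"
  assumes "b \<le> c"
  shows "(\<integral>\<^sup>+r\<in>{a..b}. f r \<partial>lborel) \<le> (\<integral>\<^sup>+r\<in>{a..c}. f r \<partial>lborel)"
  using assms by (intro nn_integral_mono) (auto split: split_indicator)

text \<open>The integral increases with \<open>s\<close>, so the event that the infimum is below
  \<open>a\<close> can be tested on rational \<open>s\<close> alone.\<close>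

lemma measurable_first_passage:
  fixes f :: "real \<Rightarrow> 'p \<Rightarrow> ennreal"
  assumes [measurable]: "(\<lambda>q. f (fst q) (snd q)) \<in> borel_measurable (borel \<Otimes>\<^sub>M P)"
  shows "(\<lambda>p. Inf {s::real. 0 \<le> s \<and> c < (\<integral>\<^sup>+r\<in>{0..s}. f r p \<partial>lborel)}) \<in> borel_measurable P"
proof (rule borel_measurable_iff_less[THEN iffD2], rule allI)
  fix a :: real
  define A where "A s p = (\<integral>\<^sup>+r\<in>{0..s}. f r p \<partial>lborel)" for s p
  have "(\<lambda>q. (snd q, fst q)) \<in> P \<Otimes>\<^sub>M lborel \<rightarrow>\<^sub>M (borel :: real measure) \<Otimes>\<^sub>M P"
    by (intro measurable_Pair measurable_fst measurable_compose[OF measurable_snd]) simp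
  from measurable_compose[OF this assms]
  have f: "(\<lambda>q. f (snd q) (fst q)) \<in> borel_measurable (P \<Otimes>\<^sub>M lborel)" by simp
  have "(\<lambda>q. f (snd q) (fst q) * indicator {0..s} (snd q)) \<in> borel_measurable (P \<Otimes>\<^sub>M lborel)" for s
    by (intro borel_measurable_times_ennreal f measurable_compose[OF measurable_snd]) simp
  then have [measurable]: "A s \<in> borel_measurable P" for s
    unfolding A_def
    by (intro sigma_finite_measure.borel_measurable_nn_integral[OF sigma_finite_lborel])
       (simp add: case_prod_unfold)
  have mono: "A s p \<le> A s' p" if "s \<le> s'" for s s' p
    unfolding A_def by (rule nn_integral_atLeastAtMost_mono[OF that])
  \<comment> \<open>If the level is never passed, the infimum of the empty set is some fixed real
    \<open>e\<close>; that case contributes the event \<open>e < a\<close>, either everything or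
    nothing.\<close>
  define e where "e = (Inf {} :: real)"
  have "Inf {s. 0 \<le> s \<and> c < A s p} < a \<longleftrightarrow>
      (\<exists>q::rat. 0 \<le> (of_rat q :: real) \<and> of_rat q < a \<and> c < A (of_rat q) p) \<or>
      ((\<forall>q::rat. 0 \<le> (of_rat q :: real) \<longrightarrow> \<not> c < A (of_rat q) p) \<and> e < a)"
    (is "Inf ?S < a \<longleftrightarrow> ?E \<or> ?N \<and> _") for p
  proof (cases "?S = {}")
    case True
    then have none: "\<not> (0 \<le> s \<and> c < A s p)" for s by (metis Collect_empty_eq)
    then have "\<not> ?E" by blast
    moreover from none have "?N" by blast
    moreover have "Inf ?S = e" unfolding e_def True ..
    ultimately show ?thesis by argo
  next
    case False
    then obtain s where s: "0 \<le> s" "c < A s p" by auto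
    obtain q where "s < of_rat q" using of_rat_dense[of s "s + 1"] by auto
    then have "0 \<le> (of_rat q :: real)" "c < A (of_rat q) p"
      using s mono[of s "of_rat q" p] by (linarith, meson less_imp_le order.strict_trans2)
    then have "\<not> ?N" by blast
    moreover have "Inf ?S < a \<longleftrightarrow> (\<exists>s\<in>?S. s < a)"
      by (rule cInf_less_iff[OF False]) (auto intro: bdd_belowI[of _ 0])
    moreover have "(\<exists>s\<in>?S. s < a) \<longleftrightarrow> ?E"
    proof
      assume "\<exists>s\<in>?S. s < a"
      then obtain s where s: "0 \<le> s" "c < A s p" "s < a" by auto
      obtain q where "s < of_rat q" "of_rat q < a" using of_rat_dense[OF s(3)] by auto
      moreover from this have "0 \<le> (of_rat q :: real)" "c < A (of_rat q) p"
        using s mono[of s "of_rat q" p] by (linarith, meson less_imp_le order.strict_trans2)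
      ultimately show ?E by blast
    qed blast
    ultimately show ?thesis by blast
  qed
  then have "{p \<in> space P. Inf {s. 0 \<le> s \<and> c < A s p} < a} = {p \<in> space P.
      (\<exists>q::rat. 0 \<le> (of_rat q :: real) \<and> of_rat q < a \<and> c < A (of_rat q) p) \<or>
      ((\<forall>q::rat. 0 \<le> (of_rat q :: real) \<longrightarrow> \<not> c < A (of_rat q) p) \<and> e < a)}"
    by blast
  also have "\<dots> \<in> sets P" by measurable
  finally show "{w \<in> space P. Inf {s. 0 \<le> s \<and> c < (\<integral>\<^sup>+r\<in>{0..s}. f r w \<partial>lborel)} < a} \<in> sets P"
    unfolding A_def .
qed

text \<open>Monotone convergence, phrased as a witness. Measurability is asked only of the cut-off
  integrands, since path values at negative times are arbitrary.\<close>

lemma nn_integral_UN_exceeds: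
  fixes f :: "'x \<Rightarrow> ennreal" and A :: "nat \<Rightarrow> 'x set"
  assumes meas: "\<And>n. (\<lambda>r. f r * indicator (A n) r) \<in> borel_measurable M" and inc: "incseq A"
    and "c < (\<integral>\<^sup>+r\<in>(\<Union>n. A n). f r \<partial>M)"
  obtains n where "c < (\<integral>\<^sup>+r\<in>A n. f r \<partial>M)"
proof -
  have "(SUP n. f r * indicator (A n) r) = f r * indicator (\<Union>n. A n) r" for r
  proof (rule antisym)
    show "f r * indicator (\<Union>n. A n) r \<le> (SUP n. f r * indicator (A n) r)"
    proof (cases "r \<in> (\<Union>n. A n)")
      case True
      then obtain n where "r \<in> A n" by blast
      then show ?thesis by (intro SUP_upper2[of n]) (auto split: split_indicator)
    qed simp
  qed (auto intro!: SUP_least split: split_indicator)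
  then have "(\<integral>\<^sup>+r\<in>(\<Union>n. A n). f r \<partial>M) = (\<integral>\<^sup>+r. (SUP n. f r * indicator (A n) r) \<partial>M)"
    by simp
  also have "\<dots> = (SUP n. \<integral>\<^sup>+r\<in>A n. f r \<partial>M)"
    using inc by (intro nn_integral_monotone_convergence_SUP meas)
       (auto simp: incseq_def le_fun_def split: split_indicator)
  finally show thesis
    using assms(3) that by (auto simp: less_SUP_iff)
qed

text \<open>The half-open interval from 0 to \<open>b\<close>, with \<open>b\<close> possibly
  infinite, is exhausted by closed intervals \<open>{0..u n}\<close>.\<close>

lemma nn_integral_before_exceeds:
  fixes f :: "real \<Rightarrow> ennreal" and b c :: ennreal
  assumes meas: "(\<lambda>r. f r * indicator {0..} r) \<in> borel_measurable borel"
    and c: "c < (\<integral>\<^sup>+r\<in>{r. 0 \<le> r \<and> ennreal r < b}. f r \<partial>lborel)"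
  obtains s where "0 \<le> s" "ennreal s < b" "c < (\<integral>\<^sup>+r\<in>{0..s}. f r \<partial>lborel)"
proof -
  note wit = that
  have approx: thesis
    if u: "incseq u" "\<And>n. 0 \<le> u n" "\<And>n. ennreal (u n) < b"
      and ex: "\<And>r. 0 \<le> r \<Longrightarrow> ennreal r < b \<Longrightarrow> \<exists>n. r \<le> u n" for u :: "nat \<Rightarrow> real"
  proof -
    have "(\<lambda>r. f r * indicator {0..} r * indicator {0..u n} r) = (\<lambda>r. f r * indicator {0..u n} r)" for n
      by (auto split: split_indicator)
    moreover have "(\<lambda>r. f r * indicator {0..} r * indicator {0..u n} r) \<in> borel_measurable lborel" for n
      using borel_measurable_times_ennreal[OF meas, of "indicator {0..u n}"] by simp
    ultimately have m: "(\<lambda>r. f r * indicator {0..u n} r) \<in> borel_measurable lborel" for n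
      by simp
    have UN: "{r. 0 \<le> r \<and> ennreal r < b} = (\<Union>n. {0..u n})"
      using ex u(3) by (auto intro: order_le_less_trans[OF ennreal_leI])
    have inc: "incseq (\<lambda>n. {0..u n})"
      using u(1) by (fastforce simp: incseq_def)
    obtain n where "c < (\<integral>\<^sup>+r\<in>{0..u n}. f r \<partial>lborel)"
      using c unfolding UN by (rule nn_integral_UN_exceeds[OF m inc])
    with u show thesis by (intro wit)
  qed
  show thesis
  proof (cases b)
    case (real a)
    have "a \<noteq> 0" using c real by auto
    with real have a: "0 < a" by simp
    show thesis
    proof (rule approx)
      \<comment> \<open>These endpoints start at 0 and increase to \<open>a\<close> without reaching
        it.\<close>
      show "incseq (\<lambda>n. a - a / real (Suc n))"
        using a by (auto simp: incseq_def intro!: divide_left_mono)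
      show "0 \<le> a - a / real (Suc n)" for n
        using a by (simp add: divide_le_eq)
      show "ennreal (a - a / real (Suc n)) < b" for n
        using a real by (auto intro: ennreal_lessI)
      fix r :: real assume "0 \<le> r" "ennreal r < b"
      then have "0 < (a - r) / a" using a real by (simp add: ennreal_less_iff)
      then obtain n where "inverse (real (Suc n)) < (a - r) / a" using reals_Archimedean by blast
      then have "a * inverse (real (Suc n)) < a - r"
        using a by (simp add: less_divide_eq mult.commute del: of_nat_Suc)
      then show "\<exists>n. r \<le> a - a / real (Suc n)"
        by (intro exI[of _ n]) (simp add: divide_inverse del: of_nat_Suc)
    qed
  next
    case top
    show thesis
      by (rule approx[of real]) (auto simp: top incseq_def real_arch_simple)
  qed
qed

corollary nn_integral_atLeast_exceeds:
  fixes f :: "real \<Rightarrow> ennreal"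
  assumes "(\<lambda>r. f r * indicator {0..} r) \<in> borel_measurable borel"
    and "c < (\<integral>\<^sup>+r\<in>{0..}. f r \<partial>lborel)"
  obtains s where "0 \<le> s" "c < (\<integral>\<^sup>+r\<in>{0..s}. f r \<partial>lborel)"
proof -
  have "{0..} = {r::real. 0 \<le> r \<and> ennreal r < top}" by auto
  with assms that show thesis
    using nn_integral_before_exceeds[of f c top] by auto
qed

section \<open>Distribution function of a positive, locally bounded rate, and its inverse\<close>

locale positive_rate =
  fixes f :: "real \<Rightarrow> real"
  assumes measurable_rate [measurable]: "f \<in> borel_measurable borel"
    and rate_pos: "\<And>r. 0 < f r"
    and rate_bounded: "\<And>s. 0 \<le> s \<Longrightarrow> bdd_above (f ` {0..s})"
begin

definition cum :: "real \<Rightarrow> ennreal" where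
  "cum s = (\<integral>\<^sup>+r\<in>{0..s}. ennreal (f r) \<partial>lborel)"

definition total_mass :: ennreal where
  "total_mass = (\<integral>\<^sup>+r\<in>{0..}. ennreal (f r) \<partial>lborel)"

text \<open>The real-valued form of \<open>cum\<close>, which makes continuity and the intermediate
  value theorem available; nothing is lost because \<open>cum\<close> is finite
  (\<open>ennreal_rcum\<close>).\<close>

definition rcum :: "real \<Rightarrow> real" where
  "rcum s = enn2real (cum s)"

definition passage :: "real \<Rightarrow> real" where
  "passage t = Inf {s. 0 < s \<and> ennreal t < cum s}"

lemma cum_mono: "a \<le> b \<Longrightarrow> cum a \<le> cum b"
  unfolding cum_def by (rule nn_integral_atLeastAtMost_mono)

text \<open>A single bound \<open>K\<close> of the rate on \<open>{0..s}\<close> serves all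
  subintervals; this yields both the finiteness of \<open>cum\<close> and a Lipschitz constant for
  \<open>rcum\<close>.\<close>

lemma nn_integral_rate_le:
  assumes "0 \<le> s"
  obtains K where "0 \<le> K" "\<And>a b. 0 \<le> a \<Longrightarrow> a \<le> b \<Longrightarrow> b \<le> s \<Longrightarrow>
    (\<integral>\<^sup>+r\<in>{a..b}. ennreal (f r) \<partial>lborel) \<le> ennreal (K * (b - a))"
proof -
  from rate_bounded[OF assms] obtain K where K: "\<And>r. 0 \<le> r \<Longrightarrow> r \<le> s \<Longrightarrow> f r \<le> K"
    unfolding bdd_above_def by (metis atLeastAtMost_iff imageI)
  have K0: "0 \<le> K" using K[of 0] assms rate_pos[of 0] by simp
  show thesis
  proof (rule that[OF K0])
    fix a b :: real assume ab: "0 \<le> a" "a \<le> b" "b \<le> s"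
    have "(\<integral>\<^sup>+r\<in>{a..b}. ennreal (f r) \<partial>lborel) \<le> (\<integral>\<^sup>+r. ennreal K * indicator {a..b} r \<partial>lborel)"
      using ab by (intro nn_integral_mono) (auto split: split_indicator intro!: ennreal_leI K)
    also have "\<dots> = ennreal (K * (b - a))"
      using ab K0 by (simp add: nn_integral_cmult_indicator ennreal_mult)
    finally show "(\<integral>\<^sup>+r\<in>{a..b}. ennreal (f r) \<partial>lborel) \<le> ennreal (K * (b - a))" .
  qed
qed

lemma cum_nonpos: "s \<le> 0 \<Longrightarrow> cum s = 0"
proof -
  assume "s \<le> 0"
  have "cum s \<le> cum 0" using \<open>s \<le> 0\<close> by (rule cum_mono)
  also have "cum 0 = 0"
    by (rule nn_integral_rate_le[of 0]) (simp_all add: cum_def)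
  finally show ?thesis by simp
qed

lemma ennreal_rcum: "ennreal (rcum s) = cum s"
proof (cases "0 \<le> s")
  case True
  then obtain K where "cum s \<le> ennreal (K * (s - 0))"
    unfolding cum_def by (rule nn_integral_rate_le) (use True in blast)
  then show ?thesis
    unfolding rcum_def by (intro ennreal_enn2real) (simp add: order_le_less_trans)
qed (simp add: cum_nonpos rcum_def)

lemma rcum_nonneg [simp]: "0 \<le> rcum s"
  by (simp add: rcum_def)

lemma rcum_0 [simp]: "rcum 0 = 0"
  by (simp add: rcum_def cum_nonpos)

lemma cum_split:
  assumes "0 \<le> a" "a \<le> b"
  shows "cum b = cum a + (\<integral>\<^sup>+r\<in>{a<..b}. ennreal (f r) \<partial>lborel)"
proof -
  have "cum b = (\<integral>\<^sup>+r. ennreal (f r) * indicator {0..a} r + ennreal (f r) * indicator {a<..b} r \<partial>lborel)"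
    unfolding cum_def using assms by (intro nn_integral_cong) (auto split: split_indicator)
  also have "\<dots> = cum a + (\<integral>\<^sup>+r\<in>{a<..b}. ennreal (f r) \<partial>lborel)"
    unfolding cum_def by (intro nn_integral_add) measurable
  finally show ?thesis .
qed

lemma nn_integral_rate_eq:
  assumes "0 \<le> a" "a \<le> b"
  shows "(\<integral>\<^sup>+r\<in>{a<..b}. ennreal (f r) \<partial>lborel) = ennreal (rcum b - rcum a)"
proof -
  have "ennreal (rcum b) = ennreal (rcum a) + (\<integral>\<^sup>+r\<in>{a<..b}. ennreal (f r) \<partial>lborel)"
    using cum_split[OF assms] by (simp add: ennreal_rcum)
  then have "(\<integral>\<^sup>+r\<in>{a<..b}. ennreal (f r) \<partial>lborel) = ennreal (rcum b) - ennreal (rcum a)"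
    by simp
  then show ?thesis by (simp add: ennreal_minus)
qed

lemma rcum_mono: "a \<le> b \<Longrightarrow> rcum a \<le> rcum b"
  using cum_mono[of a b] by (simp add: ennreal_rcum[symmetric])

text \<open>A positive rate with integral 0 over \<open>{a<..b}\<close> would make that interval a
  null set.\<close>

lemma rcum_strict_mono:
  assumes "0 \<le> a" "a < b"
  shows "rcum a < rcum b"
proof (rule ccontr)
  assume "\<not> rcum a < rcum b"
  then have "(\<integral>\<^sup>+r\<in>{a<..b}. ennreal (f r) \<partial>lborel) = 0"
    using assms by (subst nn_integral_rate_eq) (auto intro: ennreal_neg)
  then have "AE r in lborel. ennreal (f r) * indicator {a<..b} r = 0"
    by (subst (asm) nn_integral_0_iff_AE) measurable
  then have "AE r in lborel. r \<notin> {a<..b}"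
    by eventually_elim (use rate_pos in \<open>auto split: split_indicator_asm simp: ennreal_eq_0_iff not_le[symmetric]\<close>)
  then have "{a<..b} \<in> null_sets lborel"
    by (subst (asm) AE_iff_null_sets[symmetric]) auto
  then show False using assms by (simp add: null_sets_def)
qed

lemma rcum_less_iff: "0 \<le> a \<Longrightarrow> 0 \<le> b \<Longrightarrow> rcum a < rcum b \<longleftrightarrow> a < b"
  by (metis linorder_not_le rcum_mono rcum_strict_mono)

text \<open>The bound of the rate on \<open>{0..s}\<close> is a Lipschitz constant there.\<close>

lemma rcum_continuous: "continuous_on {0..s} rcum"
proof (cases "0 \<le> s")
  case True
  then obtain K where K: "0 \<le> K" "\<And>a b. 0 \<le> a \<Longrightarrow> a \<le> b \<Longrightarrow> b \<le> s \<Longrightarrow>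
    (\<integral>\<^sup>+r\<in>{a..b}. ennreal (f r) \<partial>lborel) \<le> ennreal (K * (b - a))"
    by (rule nn_integral_rate_le) blast
  have le: "\<bar>rcum b - rcum a\<bar> \<le> K * (b - a)" if "0 \<le> a" "a \<le> b" "b \<le> s" for a b
  proof -
    have "ennreal (rcum b - rcum a) = (\<integral>\<^sup>+r\<in>{a<..b}. ennreal (f r) \<partial>lborel)"
      using that by (simp add: nn_integral_rate_eq)
    also have "\<dots> \<le> (\<integral>\<^sup>+r\<in>{a..b}. ennreal (f r) \<partial>lborel)"
      by (intro nn_integral_mono) (auto split: split_indicator)
    also have "\<dots> \<le> ennreal (K * (b - a))" using that by (rule K)
    finally show ?thesis using that K(1) rcum_mono[of a b] by simp
  qed
  have "K-lipschitz_on {0..s} rcum"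
  proof (rule lipschitz_onI[OF _ K(1)])
    fix a b assume "a \<in> {0..s}" "b \<in> {0..s}"
    then show "dist (rcum a) (rcum b) \<le> K * dist a b"
      using le[of a b] le[of b a] by (cases "a \<le> b") (auto simp: dist_real_def abs_minus_commute)
  qed
  then show ?thesis by (rule lipschitz_on_continuous_on)
qed simp

lemma cum_le_total: "cum s \<le> total_mass"
  unfolding cum_def total_mass_def by (intro nn_integral_mono) (auto split: split_indicator)

lemma cum_less_total: "0 \<le> s \<Longrightarrow> ennreal (rcum s) < total_mass"
  using rcum_strict_mono[of s "s + 1"] cum_le_total[of "s + 1"]
  by (intro order_less_le_trans[OF ennreal_lessI]) (auto simp: ennreal_rcum intro: order_le_less_trans[OF rcum_nonneg])

lemma total_exceeds:
  assumes "c < total_mass"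
  obtains s where "0 \<le> s" "c < cum s"
  using assms unfolding total_mass_def cum_def by (rule nn_integral_atLeast_exceeds[rotated]) measurable

text \<open>Intermediate value theorem between 0 and a point where \<open>cum\<close> exceeds
  \<open>t\<close>. Clock times below the total mass can therefore be written as
  \<open>rcum r\<close>, the parametrisation used from here on.\<close>

lemma rcum_surj:
  assumes "0 \<le> t" "ennreal t < total_mass"
  obtains r where "0 \<le> r" "rcum r = t"
proof -
  obtain s where s: "0 \<le> s" "ennreal t < cum s" using total_exceeds[OF assms(2)] .
  then have "t \<le> rcum s" using assms(1) by (simp add: ennreal_rcum[symmetric] ennreal_less_iff)
  with s assms(1) IVT'[of rcum 0 t s] rcum_continuous[of s] that show thesis by auto
qed

text \<open>By strict monotonicity the set in the infimum is the open ray beyond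
  \<open>r\<close>.\<close>

lemma passage_rcum:
  assumes "0 \<le> r"
  shows "passage (rcum r) = r"
proof -
  have "{s. 0 < s \<and> ennreal (rcum r) < cum s} = {r<..}"
    using assms by (auto simp: ennreal_rcum[symmetric] ennreal_less_iff rcum_less_iff)
  then show ?thesis by (simp add: passage_def)
qed

text \<open>Clock times just after \<open>rcum r\<close> are values \<open>rcum q\<close> with
  \<open>q\<close> just after \<open>r\<close>. Approach strictly from the right is what composition
  with a right-continuous path requires.\<close>

lemma filterlim_passage:
  assumes "0 \<le> r"
  shows "filterlim passage (at_right r) (at_right (rcum r))"
proof -
  have ev: "\<forall>\<^sub>F t in at_right (rcum r). r < passage t \<and> passage t < b" if "r < b" for b
  proof -
    have "\<forall>\<^sub>F t in at_right (rcum r). t \<in> {rcum r<..<rcum b}"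
      using assms that by (intro eventually_at_right_real rcum_strict_mono)
    then show ?thesis
    proof eventually_elim
      case (elim t)
      have "0 \<le> t" using elim rcum_nonneg[of r] by (simp del: rcum_nonneg)
      moreover have "ennreal t < total_mass"
        using elim \<open>0 \<le> t\<close> cum_less_total[of b] assms that
        by (meson ennreal_lessI greaterThanLessThan_iff less_imp_le order_le_less_trans order_less_trans)
      ultimately obtain q where "0 \<le> q" "rcum q = t" by (rule rcum_surj)
      then show ?case using elim assms that by (auto simp: passage_rcum rcum_less_iff)
    qed
  qed
  show ?thesis
  proof (rule tendsto_imp_filterlim_at_right)
    show "(passage \<longlongrightarrow> r) (at_right (rcum r))"
    proof (rule order_tendstoI)
      fix a assume "a < r"
      then show "\<forall>\<^sub>F t in at_right (rcum r). a < passage t"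
        by (intro eventually_mono[OF ev[of "r + 1"]]) auto
    next
      fix a assume "r < a"
      then show "\<forall>\<^sub>F t in at_right (rcum r). passage t < a"
        by (intro eventually_mono[OF ev[of a]]) auto
    qed
    show "\<forall>\<^sub>F t in at_right (rcum r). r < passage t"
      using ev[of "r + 1"] by (auto elim: eventually_mono)
  qed
qed

text \<open>
  The image of \<open>f r dr\<close> under its own distribution function is Lebesgue measure. This replaces the
  classical substitution rule, which does not apply because \<open>rcum\<close> need not be differentiable.
\<close>

lemma distr_rcum:
  assumes "0 \<le> s"
  shows "distr (density lborel (\<lambda>r. ennreal (f r) * indicator {0..s} r)) borel rcum =
    density lborel (indicator {0..rcum s})"
    (is "?L = ?R")
proof (rule measure_eqI_lessThan)
  have meas [measurable]: "rcum \<in> borel_measurable borel"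
    by (intro borel_measurable_mono monoI rcum_mono)
  have L: "emeasure ?L {a<..} = (\<integral>\<^sup>+r\<in>{0..s} \<inter> {r. a < rcum r}. ennreal (f r) \<partial>lborel)" for a
    by (subst emeasure_distr, measurable, subst emeasure_density)
       (auto intro!: nn_integral_cong measurable_sets_borel[OF meas] split: split_indicator)
  have R: "emeasure ?R {a<..} = emeasure lborel ({0..rcum s} \<inter> {a<..})" for a
    by (subst emeasure_density) (auto simp: indicator_inter_arith[symmetric])
  show eq: "emeasure ?L {a<..} = emeasure ?R {a<..}" for a
  proof (cases "a < 0")
    case True
    have "{0..s} \<inter> {r. a < rcum r} = {0..s}"
      using order_less_le_trans[OF True rcum_nonneg] by auto
    moreover have "{0..rcum s} \<inter> {a<..} = {0..rcum s}" using True by auto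
    ultimately show ?thesis unfolding L R by (simp add: cum_def[symmetric] ennreal_rcum)
  next
    case False
    show ?thesis
    proof (cases "a < rcum s")
      case True
      then have "ennreal a < total_mass"
        using False cum_less_total[OF assms] by (meson ennreal_lessI not_less order_le_less_trans order_less_trans)
      \<comment> \<open>With \<open>a = rcum r\<close> the ray beyond \<open>a\<close> pulls back to
        \<open>{r<..s}\<close>, whose mass is \<open>rcum s - a\<close>, the length of
        \<open>{a<..rcum s}\<close>.\<close>
      then obtain r where r: "0 \<le> r" "rcum r = a" using False rcum_surj[of a] by auto
      have rs: "r < s" using True r assms by (simp add: rcum_less_iff[symmetric])
      have "{0..s} \<inter> {q. a < rcum q} = {r<..s}"
        using r by (auto simp: rcum_less_iff)
      moreover have "{0..rcum s} \<inter> {a<..} = {a<..rcum s}" using False by auto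
      ultimately show ?thesis
        unfolding L R using r rs True by (simp add: nn_integral_rate_eq)
    next
      case False
      then have "{0..s} \<inter> {q. a < rcum q} = {}"
        using rcum_mono[of _ s] by force
      moreover have "{0..rcum s} \<inter> {a<..} = {}" using False by auto
      ultimately show ?thesis unfolding L R by simp
    qed
  qed
  show "emeasure ?L {a<..} < \<infinity>" for a
  proof -
    have "emeasure ?R {a<..} \<le> emeasure lborel {0..rcum s}"
      unfolding R by (intro emeasure_mono) auto
    also have "\<dots> < \<infinity>" by simp
    finally show ?thesis unfolding eq .
  qed
qed simp_all

text \<open>The substitution \<open>u = rcum r\<close>, read off from the image measure.\<close>

lemma nn_integral_rcum:
  assumes [measurable]: "g \<in> borel_measurable borel" and "0 \<le> s"
  shows "(\<integral>\<^sup>+u\<in>{0..rcum s}. g u \<partial>lborel) = (\<integral>\<^sup>+r\<in>{0..s}. ennreal (f r) * g (rcum r) \<partial>lborel)"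
proof -
  have meas [measurable]: "rcum \<in> borel_measurable borel"
    by (intro borel_measurable_mono monoI rcum_mono)
  have "(\<integral>\<^sup>+u\<in>{0..rcum s}. g u \<partial>lborel) = (\<integral>\<^sup>+u. g u \<partial>density lborel (indicator {0..rcum s}))"
    by (subst nn_integral_density) (auto simp: mult.commute)
  also have "\<dots> = (\<integral>\<^sup>+r. g (rcum r) \<partial>density lborel (\<lambda>r. ennreal (f r) * indicator {0..s} r))"
    by (subst distr_rcum[OF assms(2), symmetric], subst nn_integral_distr) auto
  also have "\<dots> = (\<integral>\<^sup>+r\<in>{0..s}. ennreal (f r) * g (rcum r) \<partial>lborel)"
    by (subst nn_integral_density) (auto intro!: nn_integral_cong split: split_indicator)
  finally show ?thesis .
qed

end

section \<open>The shift map along a single path\<close>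

text \<open>Freezing the path at negative times makes the rate measurable on the whole line.\<close>

definition path_rate :: "(real \<Rightarrow> real) \<Rightarrow> real \<Rightarrow> (real \<Rightarrow> real) \<Rightarrow> real \<Rightarrow> real" where
  "path_rate R x v r = 1 / R (x + v (max 0 r))"

text \<open>On \<open>{0..s}\<close> a cadlag path stays in a compact set, the closure of its
  bounded range, and there the continuous function \<open>1 / R\<close> of the position is
  bounded.\<close>

lemma positive_rate_path_rate:
  assumes R: "continuous_on UNIV R" "\<And>y. 0 < R y" and v: "cadlag_in UNIV v"
  shows "positive_rate (path_rate R x v)"
proof
  have inv: "continuous_on UNIV (\<lambda>y. 1 / R (x + y))"
    using R(2) by (intro continuous_intros continuous_on_compose2[OF R(1)]) (auto simp: less_imp_neq[symmetric])
  have "(\<lambda>r. v (max 0 r)) \<in> borel_measurable borel"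
    by (intro right_continuous_path_measurable_real cadlag_in_imp_right_continuous_path[OF v])
  from measurable_compose[OF this borel_measurable_continuous_onI[OF inv]]
  show "path_rate R x v \<in> borel_measurable borel"
    by (simp add: path_rate_def[abs_def])
  show "0 < path_rate R x v r" for r
    by (simp add: path_rate_def R)
  show "bdd_above (path_rate R x v ` {0..s})" if "0 \<le> s" for s
  proof -
    have "compact (closure (v ` {0..s}))"
      using cadlag_bounded[OF v that] by (simp add: compact_closure)
    then have "compact ((\<lambda>y. 1 / R (x + y)) ` closure (v ` {0..s}))"
      by (intro compact_continuous_image continuous_on_subset[OF inv]) auto
    then have "bdd_above ((\<lambda>y. 1 / R (x + y)) ` closure (v ` {0..s}))"
      by (intro bounded_imp_bdd_above compact_imp_bounded)
    then show ?thesis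
      by (rule bdd_above_mono) (use closure_subset[of "v ` {0..s}"] in \<open>auto simp: path_rate_def\<close>)
  qed
qed

section \<open>Time change of a single cadlag path\<close>

locale cadlag_time_change =
  fixes R :: "real \<Rightarrow> real" and v :: "real \<Rightarrow> real" and x :: real
  assumes R_cont: "continuous_on UNIV R" and R_pos: "\<And>y. 0 < R y"
    and v_cadlag: "cadlag_in UNIV v"
begin

sublocale positive_rate "path_rate R x v"
  by (intro positive_rate_path_rate R_cont R_pos v_cadlag)

lemma clock_eq: "clock R x v = cum"
  by (auto simp: clock_def cum_def path_rate_def fun_eq_iff intro!: nn_integral_cong split: split_indicator)

lemma total_clock_eq: "total_clock R x v = total_mass"
  by (auto simp: total_clock_def total_mass_def path_rate_def intro!: nn_integral_cong split: split_indicator)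

lemma time_change_rcum: "0 \<le> r \<Longrightarrow> time_change R x v (rcum r) = ereal (x + v r)"
  by (simp add: time_change_def total_clock_eq inverse_clock_def clock_eq
      cum_less_total passage_rcum passage_def[symmetric])

lemma time_change_cases:
  assumes "0 \<le> t"
  obtains (finite) r where "0 \<le> r" "t = rcum r" "time_change R x v t = ereal (x + v r)"
  | (infinite) "total_mass \<le> ennreal t" "time_change R x v t = \<infinity>"
proof (cases "ennreal t < total_mass")
  case True
  then obtain r where "0 \<le> r" "rcum r = t" using rcum_surj assms by blast
  then show thesis using time_change_rcum[of r] finite by auto
next
  case False
  then show thesis by (intro infinite) (auto simp: time_change_def total_clock_eq)
qed

text \<open>Below the total mass the path is \<open>v\<close> composed with \<open>passage\<close>,
  which approaches its limit strictly from the right; from the total mass on it is constantly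
  infinite.\<close>

lemma right_continuous_path_time_change: "right_continuous_path (time_change R x v)"
  unfolding right_continuous_path_def
proof (intro allI impI)
  fix t :: real assume "0 \<le> t"
  then show "(time_change R x v \<longlongrightarrow> time_change R x v t) (at_right t)"
  proof (cases rule: time_change_cases)
    case (finite r)
    have "((\<lambda>s. v (passage s)) \<longlongrightarrow> v r) (at_right t)"
      unfolding \<open>t = rcum r\<close>
      by (rule filterlim_compose[OF right_continuous_pathD filterlim_passage])
         (use v_cadlag \<open>0 \<le> r\<close> in \<open>auto intro: cadlag_in_imp_right_continuous_path\<close>)
    then have "((\<lambda>s. ereal (x + v (passage s))) \<longlongrightarrow> ereal (x + v r)) (at_right t)"
      by (intro tendsto_intros)
    moreover have "\<forall>\<^sub>F s in at_right t. ereal (x + v (passage s)) = time_change R x v s"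
    proof -
      \<comment> \<open>\<open>rcum (r + 1)\<close> lies beyond \<open>t\<close> but below the total
        mass, so the finite branch governs a right neighbourhood of \<open>t\<close>.\<close>
      have "t < rcum (r + 1)" using finite by (simp add: rcum_strict_mono)
      then have "\<forall>\<^sub>F s in at_right t. s \<in> {t<..<rcum (r + 1)}"
        by (rule eventually_at_right_real)
      then show ?thesis
      proof eventually_elim
        case (elim s)
        with \<open>0 \<le> t\<close> have "ennreal s < total_mass"
          using order_less_trans[OF ennreal_lessI cum_less_total[of "r + 1"]] \<open>0 \<le> r\<close> by auto
        then show ?case
          by (simp add: time_change_def total_clock_eq inverse_clock_def clock_eq passage_def)
      qed
    qed
    ultimately show ?thesis
      unfolding finite(3) by (rule Lim_transform_eventually)
  next
    case infinite
    have "\<forall>\<^sub>F s in at_right t. \<infinity> = time_change R x v s"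
      using eventually_at_right_less[of t]
    proof eventually_elim
      case (elim s)
      then have "total_mass \<le> ennreal s" using infinite(1) by (meson ennreal_leI less_imp_le order_trans)
      then show ?case by (simp add: time_change_def total_clock_eq not_less)
    qed
    then show ?thesis
      unfolding infinite(2) by (rule Lim_transform_eventually[OF tendsto_const])
  qed
qed

text \<open>Clock times up to \<open>b\<close> come from path times in a bounded interval, on which
  the cadlag path is bounded. This rules out a return from infinity.\<close>

lemma time_change_bounded_before:
  assumes "0 \<le> b" "time_change R x v b \<noteq> \<infinity>"
  obtains n :: nat where "\<And>s. 0 \<le> s \<Longrightarrow> s \<le> b \<Longrightarrow> time_change R x v s \<le> ereal (real n)"
  using assms(1)
proof (cases rule: time_change_cases)
  case (finite \<rho>)
  obtain K where K: "\<And>r. 0 \<le> r \<Longrightarrow> r \<le> \<rho> \<Longrightarrow> \<bar>v r\<bar> \<le> K"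
    using cadlag_bounded[OF v_cadlag \<open>0 \<le> \<rho>\<close>] unfolding bounded_iff
    by (metis atLeastAtMost_iff imageI real_norm_def)
  obtain n where n: "x + K \<le> real n" using real_arch_simple by blast
  show thesis
  proof (rule that[of n])
    fix s assume s: "0 \<le> s" "s \<le> b"
    have "ennreal s < total_mass"
      using order_le_less_trans[OF ennreal_leI cum_less_total] s finite by metis
    then obtain r where r: "0 \<le> r" "rcum r = s" using rcum_surj s by blast
    then have "r \<le> \<rho>" using s finite by (meson leD not_le rcum_strict_mono)
    then show "time_change R x v s \<le> ereal (real n)"
      using time_change_rcum[of r] r K[of r] n by auto
  qed
qed (use assms in simp)

end

lemma shift_rate_measurable:
  assumes "continuous_on UNIV R" "\<And>y. 0 < R y"
  shows "shift_rate R z \<in> borel_measurable borel"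
proof -
  have [measurable]: "R \<in> borel_measurable borel"
    by (rule borel_measurable_continuous_onI[OF assms(1)])
  show ?thesis unfolding shift_rate_def[abs_def] by measurable
qed

text \<open>With \<open>A\<close> and \<open>B\<close> the clocks started at \<open>x\<close> and
  \<open>x + z\<close>, the integral in the shift map carries \<open>A.rcum r\<close> to
  \<open>B.rcum r\<close>. So the shift time of \<open>B.rcum r\<close> is \<open>A.rcum r\<close>,
  where \<open>Y\<close> has the value \<open>x + v r\<close>.\<close>

lemma shift_path_time_change:
  assumes R: "continuous_on UNIV R" "\<And>y. 0 < R y" and v: "cadlag_in UNIV v" and "0 \<le> t"
  shows "shift_path R z (time_change R x v) t = time_change R (x + z) v t"
proof -
  interpret A: cadlag_time_change R v x by standard (fact assms)+
  interpret B: cadlag_time_change R v "x + z" by standard (fact assms)+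
  define Y where "Y = time_change R x v"
  define g where "g u = ennreal (shift_rate R z (Y (max 0 u)))" for u
  define I where "I s = (\<integral>\<^sup>+u\<in>{0..s}. ennreal (shift_rate R z (Y u)) \<partial>lborel)" for s
  define T where "T = (\<integral>\<^sup>+u\<in>{0..}. ennreal (shift_rate R z (Y u)) \<partial>lborel)"
  have Y: "right_continuous_path Y"
    unfolding Y_def by (rule A.right_continuous_path_time_change)
  have g [measurable]: "g \<in> borel_measurable borel"
    unfolding g_def
    using measurable_compose[OF right_continuous_path_measurable[OF Y] shift_rate_measurable[OF R, of z]]
    by simp
  have I_g: "I s = (\<integral>\<^sup>+u\<in>{0..s}. g u \<partial>lborel)" for s
    by (auto simp: I_def g_def intro!: nn_integral_cong split: split_indicator)
  have T_g: "T = (\<integral>\<^sup>+u\<in>{0..}. g u \<partial>lborel)"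
    by (auto simp: T_def g_def intro!: nn_integral_cong split: split_indicator)
  have I_mono: "I s \<le> I s'" if "s \<le> s'" for s s'
    unfolding I_def by (rule nn_integral_atLeastAtMost_mono[OF that])
  have I_T: "I s \<le> T" for s
    unfolding I_def T_def by (intro nn_integral_mono) (auto split: split_indicator)
  \<comment> \<open>After substitution the factor \<open>R (x + v q)\<close> of the shift rate
    cancels the denominator of the rate of \<open>A\<close>, leaving the rate of
    \<open>B\<close>.\<close>
  have I_rcum: "I (A.rcum r) = ennreal (B.rcum r)" if "0 \<le> r" for r
  proof -
    have "I (A.rcum r) = (\<integral>\<^sup>+q\<in>{0..r}. ennreal (path_rate R x v q) * g (A.rcum q) \<partial>lborel)"
      unfolding I_g using that by (rule A.nn_integral_rcum[OF g])
    also have "\<dots> = (\<integral>\<^sup>+q\<in>{0..r}. ennreal (path_rate R (x + z) v q) \<partial>lborel)"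
    proof (intro nn_integral_cong)
      fix q
      have "ennreal (path_rate R x v q) * g (A.rcum q) = ennreal (path_rate R (x + z) v q)" if "0 \<le> q"
      proof -
        have "path_rate R x v q * shift_rate R z (Y (A.rcum q)) = path_rate R (x + z) v q"
          using that R(2)[of "x + v q"]
          by (simp add: Y_def A.time_change_rcum shift_rate_def path_rate_def ac_simps)
        then show ?thesis
          using that less_imp_le[OF A.rate_pos[of q]]
          by (simp add: g_def ennreal_mult'[symmetric])
      qed
      then show "ennreal (path_rate R x v q) * g (A.rcum q) * indicator {0..r} q =
          ennreal (path_rate R (x + z) v q) * indicator {0..r} q"
        by (auto split: split_indicator)
    qed
    also have "\<dots> = ennreal (B.rcum r)" by (simp add: B.ennreal_rcum B.cum_def)
    finally show ?thesis .
  qed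
  \<comment> \<open>Hence the cut-off at \<open>T\<close> cannot act before the total mass of
    \<open>B\<close>. \<open>T\<close> can be larger, because the shift rate is 1 once
    \<open>Y\<close> is infinite.\<close>
  have B_T: "B.total_mass \<le> T"
  proof (rule ccontr)
    assume "\<not> B.total_mass \<le> T"
    then obtain s where "0 \<le> s" "T < B.cum s" using B.total_exceeds[of T] by (auto simp: not_le)
    then show False using I_rcum[of s] I_T[of "A.rcum s"] by (simp add: B.ennreal_rcum)
  qed
  have shift: "shift_path R z Y t = (if ennreal t < T then ereal z + Y (Inf {s. 0 \<le> s \<and> ennreal t < I s}) else \<infinity>)"
    by (simp add: shift_path_def shift_time_def T_def I_def)
  from \<open>0 \<le> t\<close> show ?thesis
  proof (cases rule: B.time_change_cases)
    case (finite \<rho>)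
    have tT: "ennreal t < T"
      using B.cum_less_total[OF \<open>0 \<le> \<rho>\<close>] B_T finite by (metis order_less_le_trans)
    have iff: "ennreal t < I s \<longleftrightarrow> A.rcum \<rho> < s" if "0 \<le> s" for s
    proof
      assume "ennreal t < I s"
      show "A.rcum \<rho> < s"
      proof (rule ccontr)
        assume "\<not> A.rcum \<rho> < s"
        then have "I s \<le> ennreal t" using I_mono[of s "A.rcum \<rho>"] I_rcum finite by simp
        with \<open>ennreal t < I s\<close> show False by simp
      qed
    next
      assume s: "A.rcum \<rho> < s"
      \<comment> \<open>If \<open>s\<close> is past the total mass of \<open>A\<close>, no
        \<open>r\<close> has clock value \<open>s\<close>, and \<open>\<rho> + 1\<close> serves as
        the witness.\<close>
      have "\<exists>r>\<rho>. A.rcum r \<le> s"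
        using that
      proof (cases rule: A.time_change_cases)
        case (finite r)
        with s \<open>0 \<le> \<rho>\<close> show ?thesis by (auto simp: A.rcum_less_iff)
      next
        case infinite
        then have "ennreal (A.rcum (\<rho> + 1)) \<le> ennreal s"
          using A.cum_less_total[of "\<rho> + 1"] \<open>0 \<le> \<rho>\<close> by (meson add_nonneg_nonneg less_imp_le order_trans zero_le_one)
        then show ?thesis using that by (intro exI[of _ "\<rho> + 1"]) simp
      qed
      then obtain r where r: "\<rho> < r" "A.rcum r \<le> s" by auto
      have "ennreal t < ennreal (B.rcum r)"
        using finite r B.rcum_strict_mono[of \<rho> r] by (auto intro: ennreal_lessI order_le_less_trans[OF B.rcum_nonneg])
      also have "\<dots> \<le> I s" using I_rcum[of r] I_mono[OF r(2)] r finite by simp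
      finally show "ennreal t < I s" .
    qed
    then have "{s. 0 \<le> s \<and> ennreal t < I s} = {A.rcum \<rho><..}"
      using A.rcum_nonneg[of \<rho>] by (auto simp del: A.rcum_nonneg)
    then show ?thesis
      using finite tT A.time_change_rcum[of \<rho>] shift by (simp add: Y_def add_ac)
  next
    case infinite
    show ?thesis
    proof (cases "ennreal t < T")
      case True
      let ?S = "{s. 0 \<le> s \<and> ennreal t < I s}"
      have meas: "(\<lambda>u. g u * indicator {0..} u) \<in> borel_measurable borel" by measurable
      obtain s0 where s0: "0 \<le> s0" "ennreal t < I s0"
        using nn_integral_atLeast_exceeds[OF meas True[unfolded T_g]] unfolding I_g by blast
      \<comment> \<open>While \<open>Y\<close> is finite, \<open>I\<close> takes only values
        \<open>B.rcum r\<close>, which stay below \<open>t\<close>. The level is thus passed only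
        when \<open>Y\<close> is already infinite, and the same holds at the infimum.\<close>
      have ge: "A.total_mass \<le> ennreal s" if "0 \<le> s" "ennreal t < I s" for s
        using that(1)
      proof (cases rule: A.time_change_cases)
        case (finite r)
        then have "I s \<le> ennreal t"
          using I_rcum[of r] B.cum_less_total[of r] infinite(1) by (simp add: less_imp_le order.strict_trans2)
        with that show ?thesis by simp
      qed
      obtain a where a: "A.total_mass = ennreal a" "0 \<le> a"
        using ge[OF s0] by (cases A.total_mass) (auto simp: top_unique)
      have "a \<le> Inf ?S"
        using s0 ge by (intro cInf_greatest) (auto simp: a)
      then have "Y (Inf ?S) = \<infinity>"
        unfolding Y_def time_change_def A.total_clock_eq a by (simp add: ennreal_leI not_less)
      then show ?thesis using infinite shift True by (simp add: Y_def)
    qed (use infinite shift in \<open>simp add: Y_def\<close>)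
  qed
qed

section \<open>Measurability and transfer of laws\<close>

text \<open>In a complete space, a set that agrees almost everywhere with a measurable set is
  measurable.\<close>

lemma measurable_completion_cong_AE:
  fixes f g :: "'a \<Rightarrow> 'b::topological_space"
  assumes g: "g \<in> borel_measurable (completion M)" and ae: "AE \<omega> in M. f \<omega> = g \<omega>"
  shows "f \<in> borel_measurable (completion M)"
proof (rule measurableI)
  fix A :: "'b set" assume "A \<in> sets borel"
  then have g_sets: "g -` A \<inter> space (completion M) \<in> sets (completion M)"
    by (rule measurable_sets[OF g])
  have "AE \<omega> in completion M.
      \<omega> \<in> g -` A \<inter> space (completion M) \<longleftrightarrow> \<omega> \<in> f -` A \<inter> space (completion M)"
    using AE_completion[OF ae] by eventually_elim auto
  from this g_sets show "f -` A \<inter> space (completion M) \<in> sets (completion M)"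
    by (rule completion.in_sets_AE) simp
qed simp

text \<open>The integral over the single point 0 vanishes. This reconciles \<open>0 < s\<close> in
  \<open>inverse_clock\<close> with \<open>0 \<le> s\<close> in \<open>shift_time\<close>.\<close>

lemma first_passage_set_eq:
  fixes f :: "real \<Rightarrow> ennreal"
  shows "{s. 0 \<le> s \<and> c < (\<integral>\<^sup>+r\<in>{0..s}. f r \<partial>lborel)} = {s. 0 < s \<and> c < (\<integral>\<^sup>+r\<in>{0..s}. f r \<partial>lborel)}"
proof -
  have "(\<integral>\<^sup>+r\<in>{0..0}. f r \<partial>lborel) = 0"
    by (rule nn_integral_null_set) (simp add: null_sets_def)
  then have "0 < s" if "0 \<le> s" "c < (\<integral>\<^sup>+r\<in>{0..s}. f r \<partial>lborel)" for s
    using that by (cases "s = 0") auto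
  then show ?thesis by auto
qed

text \<open>The common shape of \<open>time_change\<close> and \<open>shift_path\<close>: a jointly
  measurable process evaluated at a first passage time, with value infinity if the level is not
  passed.\<close>

lemma measurable_at_first_passage:
  fixes f :: "real \<Rightarrow> 'p \<Rightarrow> ennreal" and J :: "real \<Rightarrow> 'p \<Rightarrow> ereal"
  assumes f: "(\<lambda>q. f (fst q) (snd q)) \<in> borel_measurable (borel \<Otimes>\<^sub>M P)"
    and J: "(\<lambda>q. J (fst q) (snd q)) \<in> borel_measurable (borel \<Otimes>\<^sub>M P)"
  shows "(\<lambda>p. if c < (\<integral>\<^sup>+r\<in>{0..}. f r p \<partial>lborel)
      then J (Inf {s. 0 \<le> s \<and> c < (\<integral>\<^sup>+r\<in>{0..s}. f r p \<partial>lborel)}) p else \<infinity>) \<in> borel_measurable P"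
proof (rule measurable_If)
  show "(\<lambda>p. J (Inf {s. 0 \<le> s \<and> c < (\<integral>\<^sup>+r\<in>{0..s}. f r p \<partial>lborel)}) p) \<in> borel_measurable P"
    using measurable_compose[OF measurable_Pair[OF measurable_first_passage[OF f] measurable_ident] J]
    by (simp add: id_def)
  have "(\<lambda>q. (snd q, fst q)) \<in> P \<Otimes>\<^sub>M lborel \<rightarrow>\<^sub>M (borel :: real measure) \<Otimes>\<^sub>M P"
    by (intro measurable_Pair measurable_fst measurable_compose[OF measurable_snd]) simp
  from measurable_compose[OF this f]
  have "(\<lambda>q. f (snd q) (fst q) * indicator {0..} (snd q)) \<in> borel_measurable (P \<Otimes>\<^sub>M lborel)"
    by (intro borel_measurable_times_ennreal measurable_compose[OF measurable_snd, of "indicator {0..}"]) simp_all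
  then have "(\<lambda>p. \<integral>\<^sup>+r\<in>{0..}. f r p \<partial>lborel) \<in> borel_measurable P"
    by (intro sigma_finite_measure.borel_measurable_nn_integral[OF sigma_finite_lborel])
       (simp add: case_prod_unfold)
  then show "{p \<in> space P. c < (\<integral>\<^sup>+r\<in>{0..}. f r p \<partial>lborel)} \<in> sets P"
    by measurable
qed simp

text \<open>\<open>\<xi>\<close> is measurable only coordinate by coordinate. Its grid limit
  \<open>V\<close> is jointly measurable and agrees with it on cadlag paths, hence almost
  surely.\<close>

lemma time_change_measurable:
  assumes R: "continuous_on UNIV R" "\<And>y. 0 < R y"
    and \<xi>: "\<And>t. 0 \<le> t \<Longrightarrow> \<xi> t \<in> borel_measurable M"
    and cadlag: "AE \<omega> in M. cadlag_in UNIV (\<lambda>t. \<xi> t \<omega>)"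
    and "0 \<le> t"
  shows "(\<lambda>\<omega>. time_change R x (\<lambda>s. \<xi> s \<omega>) t) \<in> borel_measurable (completion M)"
proof -
  define V where "V s \<omega> = real_of_ereal (grid_limit (\<lambda>t. ereal (\<xi> t \<omega>)) s)" for s \<omega>
  have V: "(\<lambda>q. V (fst q) (snd q)) \<in> borel_measurable (borel \<Otimes>\<^sub>M M)"
    unfolding V_def using \<xi>
    by (intro borel_measurable_real_of_ereal measurable_grid_limit borel_measurable_ereal) auto
  have R_meas: "R \<in> borel_measurable borel"
    by (rule borel_measurable_continuous_onI[OF R(1)])
  have xV: "(\<lambda>q. x + V (fst q) (snd q)) \<in> borel_measurable (borel \<Otimes>\<^sub>M M)"
    by (intro borel_measurable_add V) simp
  have "(\<lambda>y. ennreal (1 / R y)) \<in> borel_measurable borel"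
    using R_meas by measurable
  from measurable_compose[OF xV this]
  have rate: "(\<lambda>q. ennreal (1 / R (x + V (fst q) (snd q)))) \<in> borel_measurable (borel \<Otimes>\<^sub>M M)" .
  have V_eq: "V s \<omega> = \<xi> s \<omega>" if "cadlag_in UNIV (\<lambda>t. \<xi> t \<omega>)" "0 \<le> s" for s \<omega>
  proof -
    have "right_continuous_path (\<lambda>t. ereal (\<xi> t \<omega>))"
      using cadlag_in_imp_right_continuous_path[OF that(1)] by (simp add: right_continuous_path_def)
    then show ?thesis using that(2) by (simp add: V_def grid_limit_eq)
  qed
  have "(\<lambda>\<omega>. time_change R x (\<lambda>s. V s \<omega>) t) \<in> borel_measurable M"
    unfolding time_change_def total_clock_def inverse_clock_def clock_def first_passage_set_eq[symmetric]
    by (rule measurable_at_first_passage[where f = "\<lambda>r \<omega>. ennreal (1 / R (x + V r \<omega>))"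
          and J = "\<lambda>r \<omega>. ereal (x + V r \<omega>)", OF rate borel_measurable_ereal[OF xV]])
  moreover have "AE \<omega> in M. time_change R x (\<lambda>s. \<xi> s \<omega>) t = time_change R x (\<lambda>s. V s \<omega>) t"
    using cadlag
  proof eventually_elim
    case (elim \<omega>)
    interpret cadlag_time_change R "\<lambda>s. \<xi> s \<omega>" x by standard (fact R elim)+
    have int: "clock R x (\<lambda>s. V s \<omega>) s = clock R x (\<lambda>s. \<xi> s \<omega>) s"
      "total_clock R x (\<lambda>s. V s \<omega>) = total_clock R x (\<lambda>s. \<xi> s \<omega>)" for s
      unfolding clock_def total_clock_def
      by (intro nn_integral_cong; simp add: V_eq[OF elim] split: split_indicator)+
    \<comment> \<open>\<open>V\<close> and \<open>\<xi>\<close> agree at nonnegative times, so the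
      evaluation time must be shown to be nonnegative.\<close>
    have "0 \<le> inverse_clock R x (\<lambda>s. \<xi> s \<omega>) t" if "ennreal t < total_clock R x (\<lambda>s. \<xi> s \<omega>)"
    proof -
      from that have "ennreal t < total_mass" by (simp only: total_clock_eq)
      with \<open>0 \<le> t\<close> obtain r where "0 \<le> r" "rcum r = t" by (rule rcum_surj)
      then show ?thesis
        using passage_rcum[of r] by (simp add: inverse_clock_def clock_eq passage_def)
    qed
    then show ?case
      using int V_eq[OF elim] by (simp add: time_change_def inverse_clock_def)
  qed
  ultimately show ?thesis
    by (intro measurable_completion_cong_AE[OF measurable_completion])
qed

section \<open>The shift map as a measurable functional on path space\<close>

lemma measurable_grid_limit_path_space:
  "(\<lambda>q. grid_limit (snd q) (fst q)) \<in> borel_measurable (borel \<Otimes>\<^sub>M path_space)"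
  by (rule measurable_grid_limit[of "\<lambda>t w. w t"]) (simp add: path_space_def measurable_component_singleton)

lemma shift_path_grid_limit_measurable:
  assumes R: "continuous_on UNIV R" "\<And>y. 0 < R y"
  shows "(\<lambda>w. shift_path R z (grid_limit w) t) \<in> borel_measurable path_space"
proof -
  have "(\<lambda>y. ennreal (shift_rate R z y)) \<in> borel_measurable borel"
    by (rule measurable_compose[OF shift_rate_measurable[OF R] measurable_ennreal])
  note rate = measurable_compose[OF measurable_grid_limit_path_space this]
  have "(\<lambda>y. ereal z + y) \<in> borel_measurable borel"
    by (intro borel_measurable_ereal_add) simp_all
  note shifted = measurable_compose[OF measurable_grid_limit_path_space this]
  show ?thesis
    unfolding shift_path_def shift_time_def
    by (rule measurable_at_first_passage[where f = "\<lambda>r w. ennreal (shift_rate R z (grid_limit w r))"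
          and J = "\<lambda>r w. ereal z + grid_limit w r", OF rate shifted])
qed

lemma shift_rate_path_measurable:
  assumes "continuous_on UNIV R" "\<And>y. 0 < R y" and "right_continuous_path w"
  shows "(\<lambda>u. ennreal (shift_rate R z (w u)) * indicator {0..} u) \<in> borel_measurable borel"
proof -
  have "(\<lambda>u. ennreal (shift_rate R z (w (max 0 u))) * indicator {0..} u) \<in> borel_measurable borel"
    using measurable_compose[OF right_continuous_path_measurable[OF assms(3)] shift_rate_measurable[OF assms(1,2), of z]]
    by measurable
  also have "(\<lambda>u. ennreal (shift_rate R z (w (max 0 u))) * indicator {0..} u) =
      (\<lambda>u. ennreal (shift_rate R z (w u)) * indicator {0..} u)"
    by (auto split: split_indicator)
  finally show ?thesis .
qed

text \<open>The grid limit reproduces a right-continuous path at nonnegative times, and the shift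
  map reads the path only there.\<close>

lemma shift_path_grid_limit:
  assumes R: "continuous_on UNIV R" "\<And>y. 0 < R y" and w: "right_continuous_path w"
  shows "shift_path R z (grid_limit w) t = shift_path R z w t"
proof -
  have eq: "grid_limit w u = w u" if "0 \<le> u" for u
    using w that by (rule grid_limit_eq)
  have int: "(\<integral>\<^sup>+u\<in>{0..s}. ennreal (shift_rate R z (grid_limit w u)) \<partial>lborel) =
      (\<integral>\<^sup>+u\<in>{0..s}. ennreal (shift_rate R z (w u)) \<partial>lborel)"
    "(\<integral>\<^sup>+u\<in>{0..}. ennreal (shift_rate R z (grid_limit w u)) \<partial>lborel) =
      (\<integral>\<^sup>+u\<in>{0..}. ennreal (shift_rate R z (w u)) \<partial>lborel)" for s
    by (auto simp: eq intro!: nn_integral_cong split: split_indicator)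
  have "0 \<le> shift_time R z w t"
    if T: "ennreal t < (\<integral>\<^sup>+u\<in>{0..}. ennreal (shift_rate R z (w u)) \<partial>lborel)"
  proof -
    obtain s where "0 \<le> s" "ennreal t < (\<integral>\<^sup>+u\<in>{0..s}. ennreal (shift_rate R z (w u)) \<partial>lborel)"
      using nn_integral_atLeast_exceeds[OF shift_rate_path_measurable[OF R w] T] .
    then show ?thesis unfolding shift_time_def by (intro cInf_greatest) auto
  qed
  then show ?thesis
    by (simp add: shift_path_def shift_time_def int eq)
qed

text \<open>Grid times are positive for every \<open>r\<close>, so values outside
  \<open>{0..}\<close> are never read.\<close>

lemma grid_limit_restrict: "grid_limit (\<lambda>t\<in>{0..}. w t) = grid_limit w"
proof -
  have "0 \<le> grid_time n r" for n r by (simp add: grid_time_def)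
  then show ?thesis by (simp add: grid_limit_def fun_eq_iff)
qed

section \<open>Lifetimes\<close>

text \<open>
  A statement about countably many coordinates, hence a property of the law, that forces a
  right-continuous path to stay at infinity once it gets there.
\<close>

definition rationally_bounded :: "(real \<Rightarrow> ereal) \<Rightarrow> bool" where
  "rationally_bounded w \<longleftrightarrow> (\<forall>b::rat. w (max 0 (of_rat b)) = \<infinity> \<or>
     (\<exists>n::nat. \<forall>s::rat. s \<le> b \<longrightarrow> w (max 0 (of_rat s)) \<le> ereal (real n)))"

lemma rationally_bounded_measurable: "{w \<in> space path_space. rationally_bounded w} \<in> sets path_space"
proof -
  have [measurable]: "(\<lambda>w. w (max 0 (of_rat s))) \<in> borel_measurable path_space" for s :: rat
    unfolding path_space_def by (rule measurable_component_singleton) simp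
  show ?thesis unfolding rationally_bounded_def by measurable
qed

lemma (in cadlag_time_change) rationally_bounded_time_change:
  "rationally_bounded (time_change R x v)"
  unfolding rationally_bounded_def
proof (intro allI disjCI)
  fix b :: rat
  assume "\<not> (\<exists>n::nat. \<forall>s::rat. s \<le> b \<longrightarrow> time_change R x v (max 0 (of_rat s)) \<le> ereal (real n))"
  then have none: "\<exists>s::rat. s \<le> b \<and> \<not> time_change R x v (max 0 (of_rat s)) \<le> ereal (real n)" for n :: nat
    by blast
  show "time_change R x v (max 0 (of_rat b)) = \<infinity>"
  proof (rule ccontr)
    assume "time_change R x v (max 0 (of_rat b)) \<noteq> \<infinity>"
    then obtain n :: nat where n: "\<And>s. 0 \<le> s \<Longrightarrow> s \<le> max 0 (of_rat b) \<Longrightarrow> time_change R x v s \<le> ereal (real n)"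
      using time_change_bounded_before[of "max 0 (of_rat b)"] by auto
    obtain s :: rat where "s \<le> b" "\<not> time_change R x v (max 0 (of_rat s)) \<le> ereal (real n)"
      using none by blast
    moreover from this have "max 0 (of_rat s) \<le> max (0::real) (of_rat b)"
      by (intro max.mono) (auto simp: of_rat_less_eq)
    ultimately show False using n by auto
  qed
qed

text \<open>A finite value at \<open>t'\<close> persists to a rational \<open>b\<close> just after
  \<open>t'\<close>, which bounds the path at all rationals up to \<open>b\<close>. Right continuity
  at \<open>t\<close>, where the path is infinite, produces rationals before \<open>b\<close>
  exceeding that bound.\<close>

lemma absorbed_at_infinity:
  assumes w: "right_continuous_path w" and rb: "rationally_bounded w"
    and t: "0 \<le> t" "t \<le> t'" "w t = \<infinity>"
  shows "w t' = \<infinity>"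
proof (rule ccontr)
  assume fin: "w t' \<noteq> \<infinity>"
  then have "w t' < \<infinity>" by simp
  then have "\<forall>\<^sub>F s in at_right t'. w s < \<infinity>"
    using t by (intro order_tendstoD(2)[OF right_continuous_pathD[OF w]]) auto
  then obtain c where c: "t' < c" "\<And>s. t' < s \<Longrightarrow> s < c \<Longrightarrow> w s < \<infinity>"
    by (auto simp: eventually_at_right_field)
  obtain b :: rat where b: "t' < of_rat b" "of_rat b < c" using of_rat_dense[OF c(1)] by blast
  then have "max 0 (of_rat b) = (of_rat b :: real)" using t by simp
  then have "w (max 0 (of_rat b)) \<noteq> \<infinity>" using b c(2)[of "of_rat b"] by simp
  then obtain n :: nat where n: "\<And>s::rat. s \<le> b \<Longrightarrow> w (max 0 (of_rat s)) \<le> ereal (real n)"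
    using rb unfolding rationally_bounded_def by blast
  have "\<forall>\<^sub>F s in at_right t. ereal (real n) < w s"
    using t by (intro order_tendstoD(1)[OF right_continuous_pathD[OF w]]) auto
  then obtain d where d: "t < d" "\<And>s. t < s \<Longrightarrow> s < d \<Longrightarrow> ereal (real n) < w s"
    by (auto simp: eventually_at_right_field)
  have "t < min d (of_rat b)" using d b t by simp
  then obtain s :: rat where s: "t < of_rat s" "of_rat s < min d (of_rat b)"
    using of_rat_dense by blast
  then have "s \<le> b" by (simp add: of_rat_less less_imp_le)
  moreover have "max 0 (of_rat s) = (of_rat s :: real)" using s t by simp
  ultimately have "w (of_rat s) \<le> ereal (real n)" using n[of s] by simp
  moreover have "ereal (real n) < w (of_rat s)" using s by (intro d(2)) auto
  ultimately show False by simp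
qed

text \<open>Absorption makes the path infinite at all times after the lifetime; right continuity
  includes the lifetime itself, so the infimum is attained when finite.\<close>

lemma infinite_iff_lifetime_le:
  assumes w: "right_continuous_path w" and rb: "rationally_bounded w" and t: "0 \<le> t"
  shows "w t = \<infinity> \<longleftrightarrow> lifetime w \<le> ennreal t"
proof
  assume "w t = \<infinity>"
  then show "lifetime w \<le> ennreal t" unfolding lifetime_def using t by (intro INF_lower) auto
next
  assume le: "lifetime w \<le> ennreal t"
  have "w s = \<infinity>" if "t < s" for s
  proof -
    have "lifetime w < ennreal s" 
      using t that by (intro order_le_less_trans[OF le] ennreal_lessI) auto
    then obtain r where "0 \<le> r" "w r = \<infinity>" "ennreal r < ennreal s"
      unfolding lifetime_def by (auto simp: INF_less_iff)
    then show ?thesis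
      by (intro absorbed_at_infinity[OF w rb \<open>0 \<le> r\<close> _ \<open>w r = \<infinity>\<close>]) (simp add: ennreal_less_iff)
  qed
  then have "\<forall>\<^sub>F s in at_right t. \<infinity> = w s"
    using eventually_at_right_less[of t] by (auto elim: eventually_mono)
  then have "(w \<longlongrightarrow> \<infinity>) (at_right t)"
    by (rule Lim_transform_eventually[OF tendsto_const])
  then show "w t = \<infinity>"
    using tendsto_unique right_continuous_pathD[OF w t] trivial_limit_at_right_real by blast
qed

lemma lifetime_eqI:
  assumes "\<And>t. 0 \<le> t \<Longrightarrow> w t = \<infinity> \<longleftrightarrow> L \<le> ennreal t"
  shows "lifetime w = L"
proof (rule antisym)
  show "lifetime w \<le> L"
  proof (cases L)
    case (real a)
    then show ?thesis unfolding lifetime_def using assms[of a] by (intro INF_lower2[of a]) auto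
  qed simp
  show "L \<le> lifetime w"
    unfolding lifetime_def using assms by (intro INF_greatest) auto
qed

text \<open>The shifted path is finite at \<open>t\<close> exactly when level \<open>t\<close> is
  passed strictly before the lifetime of \<open>w\<close>, that is, when the mass collected before
  that lifetime exceeds \<open>t\<close>.\<close>

lemma lifetime_shift_path:
  assumes R: "continuous_on UNIV R" "\<And>y. 0 < R y"
    and w: "right_continuous_path w" and rb: "rationally_bounded w"
  shows "lifetime (shift_path R z w) =
    (\<integral>\<^sup>+s\<in>{s. 0 \<le> s \<and> ennreal s < lifetime w}. ennreal (shift_rate R z (w s)) \<partial>lborel)"
    (is "_ = ?L")
proof (rule lifetime_eqI)
  fix t :: real assume "0 \<le> t"
  define I where "I s = (\<integral>\<^sup>+u\<in>{0..s}. ennreal (shift_rate R z (w u)) \<partial>lborel)" for s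
  define T where "T = (\<integral>\<^sup>+u\<in>{0..}. ennreal (shift_rate R z (w u)) \<partial>lborel)"
  let ?S = "{s. 0 \<le> s \<and> ennreal t < I s}"
  have meas: "(\<lambda>u. ennreal (shift_rate R z (w u)) * indicator {0..} u) \<in> borel_measurable borel"
    by (rule shift_rate_path_measurable[OF R w])
  have shift: "shift_path R z w t = (if ennreal t < T then ereal z + w (Inf ?S) else \<infinity>)"
    by (simp add: shift_path_def shift_time_def T_def I_def)
  have L_T: "?L \<le> T"
    unfolding T_def by (intro nn_integral_mono) (auto split: split_indicator)
  have bdd: "bdd_below ?S" by (auto intro: bdd_belowI[of _ 0])
  show "shift_path R z w t = \<infinity> \<longleftrightarrow> ?L \<le> ennreal t"
  proof (cases "?L \<le> ennreal t")
    case True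
    have "shift_path R z w t = \<infinity>"
    proof (cases "ennreal t < T")
      case tT: True
      obtain s0 where s0: "0 \<le> s0" "ennreal t < I s0"
        using nn_integral_atLeast_exceeds[OF meas tT[unfolded T_def]] unfolding I_def .
      \<comment> \<open>For \<open>s\<close> before the lifetime, \<open>I s\<close> is part of
        \<open>?L\<close> and so at most \<open>t\<close>.\<close>
      have ge: "lifetime w \<le> ennreal s" if "0 \<le> s" "ennreal t < I s" for s
      proof (rule ccontr)
        assume "\<not> lifetime w \<le> ennreal s"
        then have "I s \<le> ?L"
          unfolding I_def
          by (intro nn_integral_mono)
             (auto simp: not_le intro: order_le_less_trans[OF ennreal_leI] split: split_indicator)
        with True that show False by (simp add: not_less[symmetric])
      qed
      obtain a where a: "lifetime w = ennreal a" "0 \<le> a"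
        using ge[OF s0] by (cases "lifetime w") (auto simp: top_unique)
      have "a \<le> Inf ?S"
        using s0 ge by (intro cInf_greatest) (auto simp: a)
      then have "w (Inf ?S) = \<infinity>"
        using a by (subst infinite_iff_lifetime_le[OF w rb]) (auto intro: ennreal_leI)
      then show ?thesis using shift by simp
    qed (simp add: shift)
    with True show ?thesis by simp
  next
    case False
    then have "ennreal t < ?L" by simp
    \<comment> \<open>Exhausting the half-open interval gives a passage at some \<open>s\<close>
      strictly before the lifetime, which then bounds the infimum.\<close>
    then obtain s where s: "0 \<le> s" "ennreal s < lifetime w" "ennreal t < I s"
      unfolding I_def by (rule nn_integral_before_exceeds[OF meas])
    then have "Inf ?S \<le> s" using bdd by (intro cInf_lower) auto
    with s have "ennreal (Inf ?S) < lifetime w" by (meson ennreal_leI order_le_less_trans)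
    moreover have "0 \<le> Inf ?S" using s by (intro cInf_greatest) auto
    ultimately have "w (Inf ?S) \<noteq> \<infinity>"
      using infinite_iff_lifetime_le[OF w rb] by (simp add: not_le)
    moreover have "ennreal t < T" using False L_T by simp
    ultimately show ?thesis using False shift by simp
  qed
qed

section \<open>Transfer from the time-changed Levy path to any process with its law\<close>

theorem proposition3p9:
  fixes M :: "'a measure" and \<xi> :: "real \<Rightarrow> 'a \<Rightarrow> real" and R :: "real \<Rightarrow> real"
    and N :: "'b measure" and X :: "real \<Rightarrow> 'b \<Rightarrow> ereal" and x z :: real
  assumes "levy_process M \<xi>" and "non_lattice M \<xi>"
    and "admissible_rate R"
    and "prob_space N"
    and "AE \<omega> in N. cadlag_in {-\<infinity><..} (\<lambda>t. X t \<omega>)"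
    and "has_path_law N X (time_changed_law M \<xi> R x)"
  shows "has_path_law N (\<lambda>t \<omega>. shift_path R z (\<lambda>s. X s \<omega>) t) (time_changed_law M \<xi> R (x + z)) \<and>
    (AE \<omega> in N. lifetime (shift_path R z (\<lambda>s. X s \<omega>)) =
       (\<integral>\<^sup>+s\<in>{s. 0 \<le> s \<and> ennreal s < lifetime (\<lambda>t. X t \<omega>)}.
          ennreal (R (real_of_ereal (X s \<omega>)) / R (z + real_of_ereal (X s \<omega>))) \<partial>lborel))"
proof -
  have R: "continuous_on UNIV R" "\<And>y. 0 < R y"
    using assms(3) by (auto simp: admissible_rate_def)
  have \<xi>: "\<And>t. 0 \<le> t \<Longrightarrow> \<xi> t \<in> borel_measurable M" "AE \<omega> in M. cadlag_in UNIV (\<lambda>t. \<xi> t \<omega>)"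
    using assms(1) by (auto simp: levy_process_def)
  have X_meas: "\<And>t. 0 \<le> t \<Longrightarrow> X t \<in> borel_measurable (completion N)"
    and law: "path_law N X = path_law M (\<lambda>t \<omega>. time_change R x (\<lambda>s. \<xi> s \<omega>) t)"
    using assms(6) by (auto simp: has_path_law_def time_changed_law_def)
  have rc: "AE \<omega> in N. right_continuous_path (\<lambda>t. X t \<omega>)"
    using assms(5) by eventually_elim (rule cadlag_in_imp_right_continuous_path)
  define Xp where "Xp \<omega> = (\<lambda>t\<in>{0..}. X t \<omega>)" for \<omega>
  define Y where "Y y \<omega> = (\<lambda>t\<in>{0..}. time_change R y (\<lambda>s. \<xi> s \<omega>) t)" for y \<omega>
  \<comment> \<open>A version of the shift map that is measurable on all of
    \<open>path_space\<close> and agrees with it on right-continuous paths at nonnegative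
    times.\<close>
  define F where "F w = (\<lambda>t\<in>{0..}. shift_path R z (grid_limit w) t)" for w
  have Xp [measurable]: "Xp \<in> completion N \<rightarrow>\<^sub>M path_space"
    unfolding Xp_def path_space_def by (intro measurable_restrict X_meas) simp
  have Y [measurable]: "Y y \<in> completion M \<rightarrow>\<^sub>M path_space" for y
    unfolding Y_def path_space_def by (intro measurable_restrict time_change_measurable R \<xi>) simp_all
  have F [measurable]: "F \<in> path_space \<rightarrow>\<^sub>M path_space"
    unfolding F_def using shift_path_grid_limit_measurable[OF R]
    by (subst (2) path_space_def) (intro measurable_restrict)
  have law': "distr (completion N) path_space Xp = distr (completion M) path_space (Y x)"
    using law unfolding path_law_def Xp_def Y_def .

  have shift_eq: "AE \<omega> in N. \<forall>t. shift_path R z (\<lambda>s. X s \<omega>) t = shift_path R z (grid_limit (Xp \<omega>)) t"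
    using rc by eventually_elim (simp add: Xp_def grid_limit_restrict shift_path_grid_limit[OF R])
  have F_Y: "AE \<omega> in M. F (Y x \<omega>) = Y (x + z) \<omega>"
    using \<xi>(2)
  proof eventually_elim
    case (elim \<omega>)
    interpret cadlag_time_change R "\<lambda>s. \<xi> s \<omega>" x by standard (fact R elim)+
    show ?case
      by (simp add: F_def Y_def grid_limit_restrict shift_path_grid_limit[OF R right_continuous_path_time_change]
          shift_path_time_change[OF R elim] cong: restrict_cong)
  qed
  have meas: "(\<lambda>\<omega>. shift_path R z (\<lambda>s. X s \<omega>) t) \<in> borel_measurable (completion N)" for t
  proof (rule measurable_completion_cong_AE)
    show "(\<lambda>\<omega>. shift_path R z (grid_limit (Xp \<omega>)) t) \<in> borel_measurable (completion N)"
      by (rule measurable_compose[OF Xp shift_path_grid_limit_measurable[OF R]])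
    show "AE \<omega> in N. shift_path R z (\<lambda>s. X s \<omega>) t = shift_path R z (grid_limit (Xp \<omega>)) t"
      using shift_eq by eventually_elim simp
  qed
  have "path_law N (\<lambda>t \<omega>. shift_path R z (\<lambda>s. X s \<omega>) t) = distr (completion N) path_space (\<lambda>\<omega>. F (Xp \<omega>))"
    unfolding path_law_def
  proof (rule distr_cong_AE)
    show "AE \<omega> in completion N. (\<lambda>t\<in>{0..}. shift_path R z (\<lambda>s. X s \<omega>) t) = F (Xp \<omega>)"
      using AE_completion[OF shift_eq] by eventually_elim (simp add: F_def)
    show "(\<lambda>\<omega>. \<lambda>t\<in>{0..}. shift_path R z (\<lambda>s. X s \<omega>) t) \<in> completion N \<rightarrow>\<^sub>M path_space"
      unfolding path_space_def by (intro measurable_restrict meas)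
  qed simp_all
  also have "\<dots> = distr (distr (completion N) path_space Xp) path_space F"
    by (simp add: distr_distr comp_def)
  \<comment> \<open>\<open>X\<close> and \<open>\<xi>\<close> live on different probability spaces;
    since \<open>F\<close> is a measurable function of the path alone, equality of the path laws
    permits the exchange.\<close>
  also have "\<dots> = distr (completion M) path_space (\<lambda>\<omega>. F (Y x \<omega>))"
    unfolding law' by (simp add: distr_distr comp_def)
  also have "\<dots> = distr (completion M) path_space (Y (x + z))"
    by (rule distr_cong_AE) (use AE_completion[OF F_Y] in simp_all)
  also have "\<dots> = time_changed_law M \<xi> R (x + z)"
    by (simp add: time_changed_law_def path_law_def Y_def[abs_def])
  finally have "has_path_law N (\<lambda>t \<omega>. shift_path R z (\<lambda>s. X s \<omega>) t) (time_changed_law M \<xi> R (x + z))"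
    using meas by (simp add: has_path_law_def)

  moreover have "AE \<omega> in N. rationally_bounded (\<lambda>t. X t \<omega>)"
  proof -
    have restrict: "rationally_bounded (\<lambda>t\<in>{0..}. w t) \<longleftrightarrow> rationally_bounded w" for w
      by (simp add: rationally_bounded_def)
    have "AE \<omega> in completion M. rationally_bounded (Y x \<omega>)"
      using AE_completion[OF \<xi>(2)]
    proof eventually_elim
      case (elim \<omega>)
      interpret cadlag_time_change R "\<lambda>s. \<xi> s \<omega>" x by standard (fact R elim)+
      show ?case by (simp add: Y_def restrict rationally_bounded_time_change)
    qed
    \<comment> \<open>A measurable set of paths of full measure under one process has full measure
      under any process with the same law.\<close>
    then have "AE w in distr (completion N) path_space Xp. rationally_bounded w"
      unfolding law' by (simp add: AE_distr_iff[OF Y rationally_bounded_measurable])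
    then show ?thesis
      by (simp add: AE_distr_iff[OF Xp rationally_bounded_measurable] AE_completion_iff Xp_def restrict)
  qed
  with rc have "AE \<omega> in N. lifetime (shift_path R z (\<lambda>s. X s \<omega>)) =
       (\<integral>\<^sup>+s\<in>{s. 0 \<le> s \<and> ennreal s < lifetime (\<lambda>t. X t \<omega>)}.
          ennreal (R (real_of_ereal (X s \<omega>)) / R (z + real_of_ereal (X s \<omega>))) \<partial>lborel)"
  proof eventually_elim
    case (elim \<omega>)
    \<comment> \<open>Before the lifetime the path is not infinite, so \<open>shift_rate\<close>
      takes its quotient branch.\<close>
    have "X s \<omega> \<noteq> \<infinity>" if "0 \<le> s" "ennreal s < lifetime (\<lambda>t. X t \<omega>)" for s
      using infinite_iff_lifetime_le[OF elim that(1)] that(2) by auto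
    then show ?case
      unfolding lifetime_shift_path[OF R elim]
      by (intro nn_integral_cong) (auto simp: shift_rate_def split: split_indicator)
  qed
  ultimately show ?thesis by simp
qed

end
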